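(* For every $n\ge1$, $\mathcal{Q}^n_2\subseteq\mathcal{Q}^n$. That is, if $Q\in\mathcal{S}^n$ satisfies $d^TQd\ge0$ for all $d\in\mathbb{R}^n$ with $e^Td=0$, then $\ell(Q)=\nu(Q)$.
   Context: $\mathcal{S}^n$ is the space of real symmetric $n\times n$ matrices, with trace inner product $\langle U,V\rangle=\sum_{i,j}U_{ij}V_{ij}$; $e\in\mathbb{R}^n$ is the all-ones vector, $E=ee^T$; $\Delta_n=\{x\in\mathbb{R}^n: e^Tx=1,\ x\ge 0\}$. $\mathcal{DN}^n$ is the cone of matrices in $\mathcal{S}^n$ that are both positive semidefinite and entrywise nonnegative. For $Q\in\mathcal{S}^n$: $\nu(Q)=\min\{x^TQx: x\in\Delta_n\}$ and $\ell(Q)=\min\{\langle Q,X\rangle:\langle E,X\rangle=1,\ X\in\mathcal{DN}^n\}$. $\mathcal{Q}^n=\{Q\in\mathcal{S}^n:\ell(Q)=\nu(Q)\}$ and $\mathcal{Q}^n_2=\{Q\in\mathcal{S}^n: d^TQd\ge 0 \text{ for all } d\in\mathbb{R}^n \text{ with } e^Td=0\}$. *)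

theory Defs
  imports "HOL-Analysis.Analysis"
begin

text \<open>
  Vectors are \<^typ>\<open>real^'n\<close> and matrices \<^typ>\<open>real^'n^'n\<close> over a finite (hence nonempty) index
  type, so that the dimension n is the cardinality of the index type. The library inner product
  on \<^typ>\<open>real^'n^'n\<close> is the sum of the products of corresponding entries, that is, the trace inner
  product; see \<open>matrix_inner_eq\<close> below.
\<close>

definition all_ones :: "real^'n" where
  "all_ones = (\<chi> i. 1)"

definition all_ones_matrix :: "real^'n^'n" where
  "all_ones_matrix = (\<chi> i j. all_ones $ i * all_ones $ j)"

definition symmetric_matrices :: "(real^'n^'n) set" where
  "symmetric_matrices = {Q. transpose Q = Q}"

definition std_simplex :: "(real^'n) set" where
  "std_simplex = {x. all_ones \<bullet> x = 1 \<and> (\<forall>i. 0 \<le> x $ i)}"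

definition psd_matrices :: "(real^'n^'n) set" where
  "psd_matrices = {X \<in> symmetric_matrices. \<forall>x. 0 \<le> x \<bullet> (X *v x)}"

definition doubly_nonneg :: "(real^'n^'n) set" where
  "doubly_nonneg = {X \<in> psd_matrices. \<forall>i j. 0 \<le> X $ i $ j}"

definition dn_feasible :: "(real^'n^'n) set" where
  "dn_feasible = {X \<in> doubly_nonneg. all_ones_matrix \<bullet> X = 1}"

text \<open>
  Both infima below are minima for every Q; this is proved in
  \<open>stqp_val_is_min\<close> and \<open>dn_bound_is_min\<close>.
\<close>

definition stqp_val :: "real^'n^'n \<Rightarrow> real" (\<open>\<nu>\<close>) where
  "\<nu> Q = (INF x \<in> std_simplex. x \<bullet> (Q *v x))"

definition dn_bound :: "real^'n^'n \<Rightarrow> real" (\<open>\<l>\<close>) where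
  "\<l> Q = (INF X \<in> dn_feasible. Q \<bullet> X)"

definition exact_dn_matrices :: "(real^'n^'n) set" where
  "exact_dn_matrices = {Q \<in> symmetric_matrices. \<l> Q = \<nu> Q}"

definition psd_on_zero_sum_matrices :: "(real^'n^'n) set" where
  "psd_on_zero_sum_matrices =
     {Q \<in> symmetric_matrices. \<forall>d. all_ones \<bullet> d = 0 \<longrightarrow> 0 \<le> d \<bullet> (Q *v d)}"

lemma matrix_inner_eq:
  fixes U V :: "real^'n^'n"
  shows "U \<bullet> V = (\<Sum>i\<in>UNIV. \<Sum>j\<in>UNIV. U $ i $ j * V $ i $ j)"
  by (simp add: inner_vec_def)

lemma INF_is_min:
  fixes f :: "'a::topological_space \<Rightarrow> real"
  assumes "compact S" "S \<noteq> {}" "continuous_on S f"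
  shows "\<exists>x\<in>S. f x = (INF y\<in>S. f y) \<and> (\<forall>y\<in>S. f x \<le> f y)"
proof -
  obtain x where x: "x \<in> S" "\<forall>y\<in>S. f x \<le> f y"
    using continuous_attains_inf[OF assms] by blast
  then have "(INF y\<in>S. f y) = f x"
    by (intro cInf_eq_minimum) auto
  with x show ?thesis by auto
qed

lemma compact_std_simplex: "compact (std_simplex :: (real^'n) set)"
proof -
  have "std_simplex \<subseteq> cbox (0 :: real^'n) (\<chi> i. 1)"
  proof
    fix x :: "real^'n" assume x: "x \<in> std_simplex"
    then have nn: "\<And>i. 0 \<le> x $ i" and s: "(\<Sum>i\<in>UNIV. x $ i) = 1"
      by (auto simp: std_simplex_def all_ones_def inner_vec_def)
    have "x $ i \<le> 1" for i
      using member_le_sum[of i UNIV "\<lambda>i. x $ i"] nn s by simp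
    with nn show "x \<in> cbox 0 (\<chi> i. 1)" by (simp add: mem_box_cart)
  qed
  moreover have "closed (std_simplex :: (real^'n) set)"
    unfolding std_simplex_def
    by (intro closed_Collect_conj closed_Collect_all closed_Collect_eq closed_Collect_le
        continuous_intros)
  ultimately show ?thesis
    by (meson bounded_cbox bounded_subset compact_eq_bounded_closed)
qed

lemma axis_in_std_simplex: "axis i 1 \<in> std_simplex"
proof -
  have "all_ones \<bullet> axis i 1 = all_ones $ i"
    by (simp add: inner_axis)
  then show ?thesis
    by (simp add: std_simplex_def all_ones_def axis_def)
qed

lemma compact_dn_feasible: "compact (dn_feasible :: (real^'n^'n) set)"
proof -
  have eq: "dn_feasible = {X :: real^'n^'n. transpose X = X \<and> (\<forall>x. 0 \<le> x \<bullet> (X *v x)) \<and>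
      (\<forall>i j. 0 \<le> X $ i $ j) \<and> all_ones_matrix \<bullet> X = 1}"
    by (auto simp: dn_feasible_def doubly_nonneg_def psd_matrices_def symmetric_matrices_def)
  have "bounded (dn_feasible :: (real^'n^'n) set)"
    unfolding bounded_iff
  proof (intro exI ballI)
    fix X :: "real^'n^'n" assume X: "X \<in> dn_feasible"
    then have nn: "\<And>i j. 0 \<le> X $ i $ j" and s: "(\<Sum>i\<in>UNIV. \<Sum>j\<in>UNIV. X $ i $ j) = 1"
      by (auto simp: eq all_ones_matrix_def all_ones_def inner_vec_def)
    have "norm X \<le> (\<Sum>i\<in>UNIV. norm (X $ i))"
      by (simp add: norm_vec_def L2_set_le_sum)
    also have "\<dots> \<le> (\<Sum>i\<in>UNIV. \<Sum>j\<in>UNIV. \<bar>X $ i $ j\<bar>)"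
      by (intro sum_mono norm_le_l1_cart)
    also have "\<dots> = 1" using nn s by simp
    finally show "norm X \<le> 1" .
  qed
  moreover have "closed (dn_feasible :: (real^'n^'n) set)"
    unfolding eq transpose_def matrix_vector_mult_def inner_vec_def vec_eq_iff
    by (intro closed_Collect_conj closed_Collect_all closed_Collect_eq closed_Collect_le)
      (simp_all, (intro continuous_intros)+)
  ultimately show ?thesis by (simp add: compact_eq_bounded_closed)
qed

lemma rank_one_in_dn_feasible:
  assumes "x \<in> std_simplex"
  shows "(\<chi> i j. x $ i * x $ j) \<in> dn_feasible"
proof -
  let ?X = "\<chi> i j. x $ i * x $ j"
  have nn: "\<And>i. 0 \<le> x $ i" and s: "(\<Sum>i\<in>UNIV. x $ i) = 1"
    using assms by (auto simp: std_simplex_def all_ones_def inner_vec_def)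
  have "y \<bullet> (?X *v y) = (x \<bullet> y)\<^sup>2" for y
    by (simp add: matrix_vector_mult_def inner_vec_def power2_eq_square sum_product
        sum_distrib_left algebra_simps)
  moreover have "all_ones_matrix \<bullet> ?X = 1"
    using s by (simp add: all_ones_matrix_def all_ones_def inner_vec_def
        flip: sum_distrib_left)
  ultimately show ?thesis
    using nn by (simp add: dn_feasible_def doubly_nonneg_def psd_matrices_def
        symmetric_matrices_def transpose_def vec_eq_iff mult.commute)
qed

lemma stqp_val_is_min:
  fixes Q :: "real^'n^'n"
  shows "\<exists>x\<in>std_simplex. x \<bullet> (Q *v x) = \<nu> Q \<and>
    (\<forall>y\<in>std_simplex. x \<bullet> (Q *v x) \<le> y \<bullet> (Q *v y))"
  unfolding stqp_val_def
proof (rule INF_is_min[OF compact_std_simplex])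
  show "std_simplex \<noteq> ({} :: (real^'n) set)" using axis_in_std_simplex by blast
  show "continuous_on std_simplex (\<lambda>x. x \<bullet> (Q *v x))"
    by (intro continuous_intros matrix_vector_mult_linear_continuous_on)
qed

lemma dn_bound_is_min:
  fixes Q :: "real^'n^'n"
  shows "\<exists>X\<in>dn_feasible. Q \<bullet> X = \<l> Q \<and> (\<forall>Y\<in>dn_feasible. Q \<bullet> X \<le> Q \<bullet> Y)"
  unfolding dn_bound_def
proof (rule INF_is_min[OF compact_dn_feasible])
  show "dn_feasible \<noteq> ({} :: (real^'n^'n) set)"
    using rank_one_in_dn_feasible axis_in_std_simplex by blast
qed (intro continuous_intros)

end

theory Submission
  imports Defs
begin

text \<open>
  The inequality \<open>\<l> Q \<le> \<nu> Q\<close> holds for every Q, because \<open>x x\<^sup>T\<close> is feasible for the relaxation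
  whenever \<open>x\<close> lies in the simplex, and has objective value \<open>x\<^sup>T Q x\<close>.

  For the converse, a feasible matrix X is rounded to the vector \<open>x = X e\<close>. Its entries are
  nonnegative and sum to \<open>e\<^sup>T X e = 1\<close>, so it lies in the simplex, and it remains to see that
  \<open>\<langle>Q, X - x x\<^sup>T\<rangle> \<ge> 0\<close>. The difference \<open>M = X - x x\<^sup>T\<close> is a deflation of X along \<open>e\<close>: it is still
  positive semidefinite by the Cauchy--Schwarz inequality for the form X
  (\<open>psd_deflate\<close>), and \<open>M e = x - x (x\<^sup>T e) = 0\<close>, so by symmetry its range consists of vectors
  with zero sum, on which the form of Q is nonnegative. A positive semidefinite matrix is a sum
  of matrices \<open>v v\<^sup>T\<close> with \<open>v\<close> in its range, hence \<open>\<langle>Q, M\<rangle>\<close> is a sum of values \<open>v\<^sup>T Q v \<ge> 0\<close>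
  (\<open>inner_psd_nonneg_on_subspace\<close>). That decomposition also comes from repeated deflation, now
  along coordinate vectors, as in the Cholesky factorization.
\<close>

definition rank_one :: "real^'n \<Rightarrow> real^'n^'n" where
  "rank_one v = (\<chi> i j. v $ i * v $ j)"

lemma rank_one_mult_vec: "rank_one v *v x = (v \<bullet> x) *\<^sub>R v"
  by (simp add: rank_one_def matrix_vector_mult_def vec_eq_iff inner_vec_def
      sum_distrib_left mult_ac)

lemma inner_rank_one:
  fixes Q :: "real^'n^'n"
  shows "Q \<bullet> rank_one v = v \<bullet> (Q *v v)"
  by (simp add: rank_one_def matrix_vector_mult_def inner_vec_def sum_distrib_left mult_ac)

lemma symmetric_rank_one: "rank_one v \<in> symmetric_matrices"
  by (simp add: symmetric_matrices_def rank_one_def transpose_def mult.commute)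

lemma symmetric_matrices_diff:
  assumes "A \<in> symmetric_matrices" "B \<in> symmetric_matrices"
  shows "A - B \<in> symmetric_matrices"
  using assms by (simp add: symmetric_matrices_def transpose_def vec_eq_iff)

lemma symmetric_inner_mult_vec:
  fixes M :: "real^'n^'n"
  assumes "M \<in> symmetric_matrices"
  shows "x \<bullet> (M *v y) = y \<bullet> (M *v x)"
  using assms by (metis (mono_tags) dot_lmul_matrix inner_commute matrix_vector_mult_def
      mem_Collect_eq symmetric_matrices_def transpose_matrix_vector)

lemma inner_axis_mult_vec_axis:
  fixes M :: "real^'n^'n"
  shows "axis i 1 \<bullet> (M *v axis j 1) = M $ i $ j"
  by (simp add: inner_axis' matrix_vector_mult_basis column_def)

text \<open>
  The quadratic \<open>t \<mapsto> (x + t y)\<^sup>T M (x + t y)\<close> is nonnegative, so its discriminant is not positive.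
\<close>

lemma psd_Cauchy_Schwarz:
  fixes M :: "real^'n^'n"
  assumes "M \<in> psd_matrices"
  shows "(x \<bullet> (M *v y))\<^sup>2 \<le> (x \<bullet> (M *v x)) * (y \<bullet> (M *v y))"
proof -
  define a b c where "a = x \<bullet> (M *v x)" and "b = x \<bullet> (M *v y)" and "c = y \<bullet> (M *v y)"
  have sym: "M \<in> symmetric_matrices" and nonneg: "\<And>z. 0 \<le> z \<bullet> (M *v z)"
    using assms by (auto simp: psd_matrices_def)
  have quad: "0 \<le> a + 2 * t * b + t\<^sup>2 * c" for t
  proof -
    have "(x + t *\<^sub>R y) \<bullet> (M *v (x + t *\<^sub>R y)) = a + 2 * t * b + t\<^sup>2 * c"
      using symmetric_inner_mult_vec[OF sym, of y x]
      by (simp add: a_def b_def c_def matrix_vector_right_distrib matrix_vector_mult_scaleR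
          inner_add_left inner_add_right power2_eq_square algebra_simps)
    then show ?thesis
      using nonneg[of "x + t *\<^sub>R y"] by simp
  qed
  have "c \<ge> 0"
    using nonneg c_def by simp
  have "b\<^sup>2 \<le> a * c"
  proof (cases "c = 0")
    case True
    have "b = 0"
    proof (rule ccontr)
      assume "b \<noteq> 0"
      \<comment> \<open>The quadratic degenerates to an affine function, which takes the value \<open>-1\<close> here.\<close>
      then show False
        using quad[of "- (a + 1) / (2 * b)"] True by (simp add: field_simps)
    qed
    then show ?thesis
      using True by simp
  next
    case False
    \<comment> \<open>The quadratic is smallest at \<open>t = - b / c\<close>.\<close>
    then have "a + 2 * (- b / c) * b + (- b / c)\<^sup>2 * c = a - b\<^sup>2 / c"
      by (simp add: field_simps power2_eq_square)
    then have "b\<^sup>2 / c \<le> a"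
      using quad[of "- b / c"] by simp
    then show ?thesis
      using False \<open>c \<ge> 0\<close> by (simp add: field_simps)
  qed
  then show ?thesis
    by (simp add: a_def b_def c_def)
qed

lemma psd_eq_0_if_diagonal_0:
  fixes M :: "real^'n^'n"
  assumes "M \<in> psd_matrices" "\<And>i. M $ i $ i = 0"
  shows "M = 0"
proof -
  have "M $ i $ j = 0" for i j
    using psd_Cauchy_Schwarz[OF assms(1), of "axis i 1" "axis j 1"] assms(2)
    by (simp add: inner_axis_mult_vec_axis)
  then show ?thesis
    by (simp add: vec_eq_iff)
qed

text \<open>
  Subtracting \<open>v v\<^sup>T\<close> with \<open>v = M u\<close> changes the form at \<open>x\<close> by \<open>(x\<^sup>T M u)\<^sup>2\<close>, which
  Cauchy--Schwarz bounds by \<open>x\<^sup>T M x\<close> exactly because of the normalization \<open>u\<^sup>T M u = 1\<close>.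
\<close>

lemma psd_deflate:
  fixes M :: "real^'n^'n"
  assumes "M \<in> psd_matrices" "u \<bullet> (M *v u) = 1"
  shows "M - rank_one (M *v u) \<in> psd_matrices"
proof -
  have "M \<in> symmetric_matrices"
    using assms(1) by (simp add: psd_matrices_def)
  moreover have "0 \<le> x \<bullet> ((M - rank_one (M *v u)) *v x)" for x
    using psd_Cauchy_Schwarz[OF assms(1), of x u] assms(2)
    by (simp add: matrix_vector_mult_diff_rdistrib rank_one_mult_vec inner_diff_right
        inner_commute power2_eq_square)
  ultimately show ?thesis
    by (simp add: psd_matrices_def symmetric_matrices_diff symmetric_rank_one)
qed

text \<open>
  This is the fact that the trace inner product of two positive semidefinite matrices is
  nonnegative, relativized to a subspace containing the range of one of them. Each deflation
  along a coordinate vector splits off a term \<open>v\<^sup>T Q v\<close> with \<open>v\<close> in the subspace, keeps the range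
  inside the subspace and turns one more diagonal entry into zero, until nothing is left.
\<close>

lemma inner_psd_nonneg_on_subspace:
  fixes Q M :: "real^'n^'n"
  assumes W: "subspace W" and Q: "\<And>d. d \<in> W \<Longrightarrow> 0 \<le> d \<bullet> (Q *v d)"
    and "M \<in> psd_matrices" "\<And>x. M *v x \<in> W"
  shows "0 \<le> Q \<bullet> M"
  using assms(3,4)
proof (induction "card {i. M $ i $ i \<noteq> 0}" arbitrary: M rule: less_induct)
  case less
  note M = \<open>M \<in> psd_matrices\<close>
  have diag_nonneg: "0 \<le> A $ i $ i" if "A \<in> psd_matrices" for A :: "real^'n^'n" and i
    using that by (auto simp: psd_matrices_def simp flip: inner_axis_mult_vec_axis)
  show ?case
  proof (cases "\<forall>i. M $ i $ i = 0")
    case True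
    then show ?thesis
      using psd_eq_0_if_diagonal_0[OF M] by simp
  next
    case False
    then obtain i where "M $ i $ i \<noteq> 0"
      by blast
    then have pos: "M $ i $ i > 0"
      using diag_nonneg[OF M, of i] by simp
    \<comment> \<open>The scaling achieves the normalization \<open>u\<^sup>T M u = 1\<close>.\<close>
    define u :: "real^'n" where "u = (1 / sqrt (M $ i $ i)) *\<^sub>R axis i 1"
    define v where "v = M *v u"
    define N where "N = M - rank_one v"
    have "u \<bullet> (M *v u) = 1"
      using pos by (simp add: u_def matrix_vector_mult_scaleR inner_axis_mult_vec_axis)
    then have N: "N \<in> psd_matrices"
      using psd_deflate[OF M] by (simp add: N_def v_def)
    have "v \<in> W"
      using less.prems(2) by (simp add: v_def)
    then have "N *v x \<in> W" for x
      using less.prems(2) W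
      by (simp add: N_def matrix_vector_mult_diff_rdistrib rank_one_mult_vec
          subspace_diff subspace_scale)
    moreover have "card {j. N $ j $ j \<noteq> 0} < card {j. M $ j $ j \<noteq> 0}"
    proof (rule psubset_card_mono)
      have N_diag: "N $ j $ j = M $ j $ j - (v $ j)\<^sup>2" for j
        by (simp add: N_def rank_one_def power2_eq_square)
      \<comment> \<open>A zero diagonal entry stays zero: it can only decrease, but remains nonnegative.\<close>
      have "N $ j $ j = 0" if "M $ j $ j = 0" for j
        using N_diag[of j] diag_nonneg[OF N, of j] that by (smt (verit) zero_le_power2)
      moreover have "N $ i $ i = 0"
      proof -
        have "v $ i = M $ i $ i / sqrt (M $ i $ i)"
          by (simp add: v_def u_def matrix_vector_mult_scaleR matrix_vector_mult_basis column_def)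
        then show ?thesis
          using pos by (simp add: N_diag real_div_sqrt)
      qed
      ultimately show "{j. N $ j $ j \<noteq> 0} \<subset> {j. M $ j $ j \<noteq> 0}"
        using \<open>M $ i $ i \<noteq> 0\<close> by blast
    qed simp
    ultimately have "0 \<le> Q \<bullet> N"
      using less.hyps N by blast
    moreover have "Q \<bullet> M = Q \<bullet> N + v \<bullet> (Q *v v)"
      by (simp add: N_def inner_diff_right inner_rank_one)
    ultimately show ?thesis
      using Q[OF \<open>v \<in> W\<close>] by simp
  qed
qed

lemma inner_all_ones_matrix:
  "all_ones_matrix \<bullet> X = all_ones \<bullet> (X *v all_ones)"
  by (simp add: all_ones_matrix_def all_ones_def inner_vec_def matrix_vector_mult_def)

lemma row_sums_in_std_simplex:
  assumes "X \<in> dn_feasible"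
  shows "X *v all_ones \<in> std_simplex"
  using assms
  by (auto simp: dn_feasible_def doubly_nonneg_def std_simplex_def inner_all_ones_matrix
      matrix_vector_mult_def all_ones_def intro!: sum_nonneg)

lemma row_sums_objective_le:
  fixes Q X :: "real^'n^'n"
  assumes Q: "Q \<in> psd_on_zero_sum_matrices" and X: "X \<in> dn_feasible"
  shows "(X *v all_ones) \<bullet> (Q *v (X *v all_ones)) \<le> Q \<bullet> X"
proof -
  define x where "x = X *v all_ones"
  define M where "M = X - rank_one x"
  have "X \<in> psd_matrices" and norm: "all_ones \<bullet> (X *v all_ones) = 1"
    using X by (auto simp: dn_feasible_def doubly_nonneg_def inner_all_ones_matrix)
  then have M: "M \<in> psd_matrices"
    using psd_deflate by (simp add: M_def x_def)
  have "M *v all_ones = 0"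
    using norm by (simp add: M_def x_def matrix_vector_mult_diff_rdistrib rank_one_mult_vec
        inner_commute)
  then have "all_ones \<bullet> (M *v y) = 0" for y
    using M symmetric_inner_mult_vec[of M all_ones y] by (simp add: psd_matrices_def)
  then have "0 \<le> Q \<bullet> M"
    using Q M
    by (intro inner_psd_nonneg_on_subspace[of "{d. all_ones \<bullet> d = 0}"])
      (auto simp: psd_on_zero_sum_matrices_def subspace_hyperplane)
  then show ?thesis
    by (simp add: M_def x_def inner_diff_right inner_rank_one)
qed

lemma dn_bound_le_stqp_val: "\<l> Q \<le> \<nu> Q"
proof -
  obtain x where x: "x \<in> std_simplex" "x \<bullet> (Q *v x) = \<nu> Q"
    using stqp_val_is_min by blast
  have "rank_one x \<in> dn_feasible"
    using rank_one_in_dn_feasible[OF x(1)] by (simp add: rank_one_def)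
  then have "\<l> Q \<le> Q \<bullet> rank_one x"
    using dn_bound_is_min[of Q] by auto
  then show ?thesis
    using x(2) by (simp add: inner_rank_one)
qed

lemma stqp_val_le_dn_bound:
  assumes "Q \<in> psd_on_zero_sum_matrices"
  shows "\<nu> Q \<le> \<l> Q"
proof -
  obtain X where X: "X \<in> dn_feasible" "Q \<bullet> X = \<l> Q"
    using dn_bound_is_min by blast
  have "\<nu> Q \<le> (X *v all_ones) \<bullet> (Q *v (X *v all_ones))"
    using stqp_val_is_min[of Q] row_sums_in_std_simplex[OF X(1)] by auto
  also have "\<dots> \<le> \<l> Q"
    using row_sums_objective_le[OF assms X(1)] X(2) by simp
  finally show ?thesis .
qed

theorem proposition4p3:
  shows "(psd_on_zero_sum_matrices :: (real^'n^'n) set) \<subseteq> exact_dn_matrices"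
proof
  fix Q :: "real^'n^'n"
  assume Q: "Q \<in> psd_on_zero_sum_matrices"
  then have "Q \<in> symmetric_matrices"
    by (simp add: psd_on_zero_sum_matrices_def)
  moreover have "\<l> Q = \<nu> Q"
    using dn_bound_le_stqp_val stqp_val_le_dn_bound[OF Q] by (rule antisym)
  ultimately show "Q \<in> exact_dn_matrices"
    by (simp add: exact_dn_matrices_def)
qed

end
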